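(* Let $l_x,l_y,l_z,u_z$ be real numbers with $0<l_z<u_z<1$, $l_z\le l_x\le u_z$, $l_z\le l_y\le u_z$ and $l_xl_y<l_z$. Suppose that $(l_x,l_y)$ is in region C, i.e. $l_z\le l_x\le\sqrt{l_zu_z}$ and $\sqrt{l_zu_z}\le l_y\le\sqrt{l_z/u_z}$. Let $\mathcal F'=\{(x,y,z)\in\mathbb R^3 : z=xy,\ l_x\le x\le 1,\ l_y\le y\le 1,\ l_z\le z\le u_z\}$ and let $$M_2=\begin{pmatrix}1 & 2l_z-u_z\\ 2l_z-u_z & u_z^2\end{pmatrix}$$ (which is positive semidefinite). Then $\operatorname{conv}(\mathcal F')$ is exactly the set of $(x,y,z)\in\mathbb R^3$ satisfying the RLT constraints $$z\ge x+y-1,\qquad z\ge l_yx+l_xy-l_xl_y,\qquad z\le x+l_xy-l_x,\qquad z\le l_yx+y-l_y,$$ the bounds $l_z\le z\le u_z$, and the following three second-order cone constraints, each imposed only when $(x,y)$ is in the indicated region: 1. if $y\ge(l_y^2/l_z)x$ and $y\le x/u_z$, then $(z+\sqrt{l_zu_z})^2\le(\sqrt{l_z}+\sqrt{u_z})^2\,xy$; 2. if $y\le(l_y^2/l_z)x$, then, with $l_x':=l_z/l_y$, $$u_z(z-l_x'l_y)^2\le\big(u_z(x-l_x')+l_x'(z-l_yx)\big)\big(u_z(y-l_y)+l_y(z-l_x'y)\big);$$ 3. if $x\le u_zy$, then $\sqrt{(\hat x,\hat y)M_2(\hat x,\hat y)^T}\le x+u_zy-2z$, where $\hat x:=u_z-x$,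 $\hat y:=1-y$.
   Context: $\operatorname{conv}$ denotes the convex hull in $\mathbb R^3$. "RLT" stands for Reformulation-Linearization Technique; the RLT constraints are written out in the claim for the box $l_x\le x\le 1$, $l_y\le y\le 1$. *)

theory Defs
  imports "HOL-Analysis.Analysis"
begin

definition bounded_product_set :: "real \<Rightarrow> real \<Rightarrow> real \<Rightarrow> real \<Rightarrow> (real ^ 3) set" where
  "bounded_product_set lx ly lz uz =
     {vector [x, y, z] | x y z.
        z = x * y \<and> lx \<le> x \<and> x \<le> 1 \<and> ly \<le> y \<and> y \<le> 1 \<and> lz \<le> z \<and> z \<le> uz}"

definition region_C :: "real \<Rightarrow> real \<Rightarrow> real \<Rightarrow> real \<Rightarrow> bool" where
  "region_C lx ly lz uz \<longleftrightarrow>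
     lz \<le> lx \<and> lx \<le> sqrt (lz * uz) \<and> sqrt (lz * uz) \<le> ly \<and> ly \<le> sqrt (lz / uz)"

text \<open>The RLT constraints for the box \<open>lx \<le> x \<le> 1\<close>, \<open>ly \<le> y \<le> 1\<close>: the linearizations,
  with \<open>z\<close> in place of \<open>x * y\<close>, of the products of one bound constraint on \<open>x\<close> and one on \<open>y\<close>.\<close>

definition RLT :: "real \<Rightarrow> real \<Rightarrow> real \<Rightarrow> real \<Rightarrow> real \<Rightarrow> bool" where
  "RLT lx ly x y z \<longleftrightarrow>
     z \<ge> x + y - 1 \<and>
     z \<ge> ly * x + lx * y - lx * ly \<and>
     z \<le> x + lx * y - lx \<and>
     z \<le> ly * x + y - ly"

definition positive_semidefinite :: "real ^ 'n ^ 'n \<Rightarrow> bool" where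
  "positive_semidefinite A \<longleftrightarrow> transpose A = A \<and> (\<forall>v. 0 \<le> v \<bullet> (A *v v))"

definition M2 :: "real \<Rightarrow> real \<Rightarrow> real ^ 2 ^ 2" where
  "M2 lz uz = vector [vector [1, 2 * lz - uz],
                      vector [2 * lz - uz, uz\<^sup>2]]"

definition SOC1 :: "real \<Rightarrow> real \<Rightarrow> real \<Rightarrow> real \<Rightarrow> real \<Rightarrow> bool" where
  "SOC1 lz uz x y z \<longleftrightarrow>
     (z + sqrt (lz * uz))\<^sup>2 \<le> (sqrt lz + sqrt uz)\<^sup>2 * (x * y)"

definition SOC2 :: "real \<Rightarrow> real \<Rightarrow> real \<Rightarrow> real \<Rightarrow> real \<Rightarrow> real \<Rightarrow> bool" where
  "SOC2 ly lz uz x y z \<longleftrightarrow>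
     (let lx' = lz / ly in
        uz * (z - lx' * ly)\<^sup>2 \<le>
          (uz * (x - lx') + lx' * (z - ly * x)) * (uz * (y - ly) + ly * (z - lx' * y)))"

definition SOC3 :: "real \<Rightarrow> real \<Rightarrow> real \<Rightarrow> real \<Rightarrow> real \<Rightarrow> bool" where
  "SOC3 lz uz x y z \<longleftrightarrow>
     (let v = (vector [uz - x, 1 - y] :: real ^ 2) in
        sqrt (v \<bullet> (M2 lz uz *v v)) \<le> x + uz * y - 2 * z)"

end

theory Submission
  imports Defs
begin

text \<open>
  Write \<open>l\<close>, \<open>u\<close> for the bounds on \<open>z\<close>. Convexity of the right-hand side is never needed. Each cone
  constraint is the envelope of a one-parameter family of linear inequalities valid on the whole
  nonconvex set, hence on its hull; at a point of the region of the constraint, the extremal member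
  of the family is among the valid ones, and it gives the constraint.

  Conversely, it suffices to find hull points directly above and below a given point. Above it,
  the boundary is ruled by segments: radial ones between the hyperbolas \<open>x * y = l\<close> and
  \<open>x * y = u\<close> for the first constraint, and segments issuing from the apex \<open>(l / ly, ly, l)\<close> for the
  second and \<open>(u, 1, u)\<close> for the third. Where the ray from the apex leaves the box before it meets
  the hyperbola, an RLT facet takes over. Below it, the boundary consists of two quadrilateral
  RLT facets and a part of the plane \<open>z = l\<close>.
\<close>

section \<open>Weights on a planar quadrilateral\<close>

text \<open>The ray from the origin through \<open>(p, q)\<close> crosses the two bounding lines at
  \<open>(p, q) / A\<close> and \<open>(p, q) / B\<close>; \<open>t\<close> and \<open>t'\<close>
  locate the crossings between the axes, and \<open>s\<close> locates \<open>(p, q)\<close> between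
  the crossings.\<close>

lemma ex_quadrilateral_weights:
  fixes p q a1 b1 a2 b2 :: real
  assumes "0 \<le> p" "0 \<le> q" "0 < a1" "0 < b1" "0 < a2" "0 < b2"
    and ge: "1 \<le> p / a1 + q / b1" and le: "p / a2 + q / b2 \<le> 1"
  obtains s t t' where "0 \<le> s" "s \<le> 1" "0 \<le> t" "t \<le> 1" "0 \<le> t'" "t' \<le> 1"
    "p = (1 - s) * ((1 - t) * a1) + s * ((1 - t') * a2)"
    "q = (1 - s) * (t * b1) + s * (t' * b2)"
proof -
  define A B where "A = p / a1 + q / b1" and "B = p / a2 + q / b2"
  have A: "1 \<le> A" and B: "B \<le> 1" using ge le by (auto simp: A_def B_def)
  have "p \<noteq> 0 \<or> q \<noteq> 0" using ge by auto
  then have B0: "0 < B"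
    using assms(1-6) by (auto simp: B_def intro: add_pos_nonneg add_nonneg_pos)
  define t t' where "t = q / b1 / A" and "t' = q / b2 / B"
  have t: "1 - t = p / a1 / A"
  proof -
    have "p / a1 = A - q / b1" by (simp add: A_def)
    then show ?thesis using A by (simp add: t_def diff_divide_distrib)
  qed
  have t': "1 - t' = p / a2 / B"
  proof -
    have "p / a2 = B - q / b2" by (simp add: B_def)
    then show ?thesis using B0 by (simp add: t'_def diff_divide_distrib)
  qed
  \<comment> \<open>The solution of \<open>(1 - s) / A + s / B = 1\<close>. If \<open>A = B\<close>,
    both are 1 and every \<open>s\<close> solves it.\<close>
  define s where "s = (if A = B then 0 else (1 - 1 / A) / (1 / B - 1 / A))"
  have AB: "B \<le> A" using A B by simp
  have s: "0 \<le> s" "s \<le> 1"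
    using A B B0 AB by (auto simp: s_def field_simps)
  have s1: "(1 - s) / A + s / B = 1"
  proof (cases "A = B")
    case True
    then show ?thesis using A B by (simp add: s_def)
  next
    case False
    then have "s * (1 / B - 1 / A) = 1 - 1 / A"
      using A B0 by (simp add: s_def field_simps)
    then show ?thesis by (simp add: algebra_simps diff_divide_distrib)
  qed
  have "(1 - s) * ((1 - t) * a1) + s * ((1 - t') * a2) = p * ((1 - s) / A + s / B)"
    unfolding t t' using assms(3,5) by (simp add: algebra_simps)
  moreover have "(1 - s) * (t * b1) + s * (t' * b2) = q * ((1 - s) / A + s / B)"
    unfolding t_def t'_def using assms(4,6) by (simp add: algebra_simps)
  moreover have "0 \<le> t" "0 \<le> t'" "0 \<le> 1 - t" "0 \<le> 1 - t'"
    unfolding t t' using assms(1-6) A B0 by (auto simp: t_def t'_def)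
  ultimately show ?thesis using s s1 that[of s t t'] by simp
qed

section \<open>The matrix \<open>M2\<close> and the cone constraints seen from their apexes\<close>

lemma M2_quadratic_form:
  fixes v :: "real ^ 2"
  shows "v \<bullet> (M2 l u *v v) = (v $ 1)\<^sup>2 + 2 * (2 * l - u) * (v $ 1 * v $ 2) + u\<^sup>2 * (v $ 2)\<^sup>2"
  by (simp add: M2_def inner_vec_def matrix_vector_mult_def sum_2 power2_eq_square algebra_simps)

text \<open>Completing the square in the first coordinate leaves
  \<open>u\<^sup>2 - (2 * l - u)\<^sup>2 = 4 * (l * (u - l))\<close> for the second.\<close>

lemma positive_semidefinite_M2:
  assumes "0 \<le> l" "l \<le> u"
  shows "positive_semidefinite (M2 l u)"
  unfolding positive_semidefinite_def
proof (intro conjI allI)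
  show "transpose (M2 l u) = M2 l u"
    by (simp add: M2_def transpose_def vec_eq_iff forall_2)
  fix v :: "real ^ 2"
  have "v \<bullet> (M2 l u *v v) = (v $ 1 + (2 * l - u) * v $ 2)\<^sup>2 + 4 * (l * (u - l)) * (v $ 2)\<^sup>2"
    unfolding M2_quadratic_form by (simp add: power2_eq_square algebra_simps)
  then show "0 \<le> v \<bullet> (M2 l u *v v)" using assms by simp
qed

text \<open>With \<open>p = u - x\<close>, \<open>q = 1 - y\<close>, \<open>w = u - z\<close>, the
  radicand is the discriminant of \<open>w\<^sup>2 - w * (p + u * q) + (u - l) * (p * q)\<close>, so
  the constraint says that \<open>w\<close> is at least the larger root.\<close>

lemma SOC3_iff:
  "SOC3 l u x y z \<longleftrightarrow>
     sqrt ((u - x + u * (1 - y))\<^sup>2 - 4 * (u - l) * ((u - x) * (1 - y))) \<le> 2 * (u - z) - (u - x + u * (1 - y))"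
proof -
  have "(u - x)\<^sup>2 + 2 * (2 * l - u) * ((u - x) * (1 - y)) + u\<^sup>2 * (1 - y)\<^sup>2
      = (u - x + u * (1 - y))\<^sup>2 - 4 * (u - l) * ((u - x) * (1 - y))"
    by (simp add: power2_eq_square algebra_simps)
  then show ?thesis
    unfolding SOC3_def Let_def M2_quadratic_form by simp (simp add: algebra_simps)
qed

text \<open>Since \<open>lx' * ly = l\<close>, both factors depend only on the displacement from the
  apex \<open>(l / ly, ly, l)\<close>.\<close>

lemma SOC2_iff:
  assumes "ly \<noteq> 0"
  shows "SOC2 ly l u x y z \<longleftrightarrow>
     u * (z - l)\<^sup>2 \<le> ((u - l) * (x - l / ly) + l / ly * (z - l)) * ((u - l) * (y - ly) + ly * (z - l))"
proof -
  obtain m where m: "l = m * ly" using assms by (metis nonzero_divide_eq_eq)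
  show ?thesis using assms unfolding SOC2_def Let_def m
    by (simp add: algebra_simps)
qed

section \<open>The setting and the hull\<close>

text \<open>The last three assumptions are the square-root bounds of region C in squared
  form.\<close>

locale region_C_box =
  fixes lx ly l u :: real
  assumes l_pos: "0 < l" and l_u: "l < u" and u_1: "u < 1"
    and l_lx: "l \<le> lx" and lx_u: "lx \<le> u" and l_ly: "l \<le> ly" and ly_u: "ly \<le> u"
    and lx_ly: "lx * ly < l"
    and lx_sq: "lx\<^sup>2 \<le> l * u" and ly_sq_ge: "l * u \<le> ly\<^sup>2" and ly_sq_le: "ly\<^sup>2 * u \<le> l"
begin

abbreviation in_hull :: "real \<Rightarrow> real \<Rightarrow> real \<Rightarrow> bool" where
  "in_hull x y z \<equiv> (vector [x, y, z] :: real ^ 3) \<in> convex hull bounded_product_set lx ly l u"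

text \<open>The projection of the nonconvex set to the \<open>(x, y)\<close> plane.\<close>

definition feasible :: "real \<Rightarrow> real \<Rightarrow> bool" where
  "feasible x y \<longleftrightarrow> lx \<le> x \<and> x \<le> 1 \<and> ly \<le> y \<and> y \<le> 1 \<and> l \<le> x * y \<and> x * y \<le> u"

lemma in_hull_product: "feasible x y \<Longrightarrow> z = x * y \<Longrightarrow> in_hull x y z"
  unfolding feasible_def by (intro hull_inc) (auto simp: bounded_product_set_def)

lemma in_hull_mix:
  assumes "in_hull x1 y1 z1" "in_hull x2 y2 z2" "0 \<le> t" "t \<le> 1"
    and "x = (1 - t) * x1 + t * x2" "y = (1 - t) * y1 + t * y2" "z = (1 - t) * z1 + t * z2"
  shows "in_hull x y z"
proof -
  have "(vector [x, y, z] :: real ^ 3) = (1 - t) *\<^sub>R vector [x1, y1, z1] + t *\<^sub>R vector [x2, y2, z2]"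
    using assms(5-7) by (simp add: vec_eq_iff forall_3)
  then show ?thesis
    using convexD_alt[OF convex_convex_hull assms(1-4)] by simp
qed

text \<open>A half-space is convex, so it contains the hull once it contains the set. All necessity
  proofs reduce to this: the inequality is checked on the surface \<open>z = x * y\<close>.\<close>

lemma in_hull_linear_bound:
  assumes "in_hull x y z" and bound: "\<And>x y. feasible x y \<Longrightarrow> a * x + b * y + c * (x * y) \<le> d"
  shows "a * x + b * y + c * z \<le> d"
proof -
  let ?n = "vector [a, b, c] :: real ^ 3"
  have "bounded_product_set lx ly l u \<subseteq> {v. ?n \<bullet> v \<le> d}"
    using bound by (auto simp: bounded_product_set_def feasible_def inner_vec_def sum_3)
  then have "convex hull bounded_product_set lx ly l u \<subseteq> {v. ?n \<bullet> v \<le> d}"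
    by (intro hull_minimal convex_halfspace_le)
  then show ?thesis using assms(1) by (auto simp: inner_vec_def sum_3 subset_iff)
qed

lemma lx_pos: "0 < lx" and ly_pos: "0 < ly"
  using l_pos l_lx l_ly by auto

lemma lx_less_u: "lx < u"
proof -
  have "lx\<^sup>2 < u\<^sup>2"
    using lx_sq l_u l_pos by (smt (verit) mult_strict_right_mono power2_eq_square)
  then show ?thesis using l_pos l_u by (simp add: power2_less_imp_less)
qed

lemma l_less_ly: "l < ly"
proof -
  have "l\<^sup>2 < ly\<^sup>2"
    using ly_sq_ge l_u l_pos by (smt (verit) mult_strict_left_mono power2_eq_square)
  then show ?thesis using ly_pos by (simp add: power2_less_imp_less)
qed

section \<open>Necessity of the linear constraints\<close>

lemma RLT_of_in_hull:
  assumes "in_hull x y z"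
  shows "RLT lx ly x y z"
proof -
  have "1 * x + 1 * y + (-1) * z \<le> 1"
  proof (rule in_hull_linear_bound[OF assms])
    fix x y assume "feasible x y"
    then have "0 \<le> (1 - x) * (1 - y)" by (auto simp: feasible_def)
    then show "1 * x + 1 * y + (-1) * (x * y) \<le> 1" by (simp add: algebra_simps)
  qed
  moreover have "ly * x + lx * y + (-1) * z \<le> lx * ly"
  proof (rule in_hull_linear_bound[OF assms])
    fix x y assume "feasible x y"
    then have "0 \<le> (x - lx) * (y - ly)" by (auto simp: feasible_def)
    then show "ly * x + lx * y + (-1) * (x * y) \<le> lx * ly" by (simp add: algebra_simps)
  qed
  moreover have "(-1) * x + (- lx) * y + 1 * z \<le> - lx"
  proof (rule in_hull_linear_bound[OF assms])
    fix x y assume "feasible x y"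
    then have "0 \<le> (x - lx) * (1 - y)" by (auto simp: feasible_def)
    then show "(-1) * x + (- lx) * y + 1 * (x * y) \<le> - lx" by (simp add: algebra_simps)
  qed
  moreover have "(- ly) * x + (-1) * y + 1 * z \<le> - ly"
  proof (rule in_hull_linear_bound[OF assms])
    fix x y assume "feasible x y"
    then have "0 \<le> (1 - x) * (y - ly)" by (auto simp: feasible_def)
    then show "(- ly) * x + (-1) * y + 1 * (x * y) \<le> - ly" by (simp add: algebra_simps)
  qed
  ultimately show ?thesis by (simp add: RLT_def)
qed

lemma bounds_of_in_hull:
  assumes "in_hull x y z"
  shows "l \<le> z" "z \<le> u"
  using in_hull_linear_bound[OF assms, of 0 0 1 u] in_hull_linear_bound[OF assms, of 0 0 "-1" "- l"]
  by (auto simp: feasible_def)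

text \<open>Chaining a lower and an upper RLT bound eliminates \<open>z\<close> and leaves a box
  bound multiplied by \<open>1 - lx\<close> or \<open>1 - ly\<close>.\<close>

lemma RLT_box:
  assumes "RLT lx ly x y z"
  shows "lx \<le> x" "x \<le> 1" "ly \<le> y" "y \<le> 1"
proof -
  have "0 \<le> (1 - ly) * (1 - x)" "0 \<le> (1 - lx) * (1 - y)"
    "0 \<le> (1 - ly) * (x - lx)" "0 \<le> (1 - lx) * (y - ly)"
    using assms by (simp_all add: RLT_def algebra_simps)
  moreover have "0 < 1 - ly" "0 < 1 - lx" using ly_u lx_u u_1 by auto
  ultimately show "lx \<le> x" "x \<le> 1" "ly \<le> y" "y \<le> 1"
    by (simp_all add: zero_le_mult_iff)
qed

section \<open>Necessity of the cone constraints\<close>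

text \<open>On the surface, \<open>s = sqrt (x * y)\<close> lies between \<open>sqrt l\<close> and
  \<open>sqrt u\<close>, so \<open>(s - sqrt l) * (sqrt u - s) \<ge> 0\<close> bounds
  \<open>x * y\<close> by a linear function of \<open>s\<close>. AM-GM,
  \<open>2 * (a * s) \<le> x + a\<^sup>2 * y\<close>, makes the bound linear in \<open>x\<close> and
  \<open>y\<close>.\<close>

lemma SOC1_plane:
  assumes "in_hull x y z" "0 < a"
  shows "2 * a * (z + sqrt (l * u)) \<le> (sqrt l + sqrt u) * (x + a\<^sup>2 * y)"
proof -
  let ?k = "sqrt l + sqrt u"
  have "(- ?k) * x + (- ?k * a\<^sup>2) * y + (2 * a) * z \<le> - (2 * a * sqrt (l * u))"
  proof (rule in_hull_linear_bound[OF assms(1)])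
    fix x y assume f: "feasible x y"
    then have pos: "0 < x" "0 < y" using lx_pos ly_pos by (auto simp: feasible_def)
    define s where "s = sqrt (x * y)"
    have s2: "s * s = x * y" using pos by (simp add: s_def)
    have "sqrt l \<le> s" "s \<le> sqrt u" using f by (auto simp: s_def feasible_def)
    then have "0 \<le> (s - sqrt l) * (sqrt u - s)" by simp
    then have "x * y + sqrt (l * u) \<le> ?k * s"
      using s2 by (simp add: algebra_simps real_sqrt_mult)
    then have "2 * a * (x * y + sqrt (l * u)) \<le> 2 * a * (?k * s)"
      using assms(2) by (intro mult_left_mono) auto
    also have "\<dots> = ?k * (2 * (a * s))" by simp
    also have "\<dots> \<le> ?k * (x + a\<^sup>2 * y)"
    proof (rule mult_left_mono)
      have "2 * (sqrt x * (a * sqrt y)) \<le> (sqrt x)\<^sup>2 + (a * sqrt y)\<^sup>2"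
        using sum_squares_bound[of "sqrt x" "a * sqrt y"] by (simp add: algebra_simps)
      then show "2 * (a * s) \<le> x + a\<^sup>2 * y"
        using pos by (simp add: s_def real_sqrt_mult power_mult_distrib algebra_simps)
    qed (use l_pos l_u in auto)
    finally show "(- ?k) * x + (- ?k * a\<^sup>2) * y + (2 * a) * (x * y) \<le> - (2 * a * sqrt (l * u))"
      by (simp add: algebra_simps)
  qed
  then show ?thesis by (simp add: algebra_simps)
qed

lemma SOC1_of_in_hull:
  assumes "in_hull x y z"
  shows "SOC1 l u x y z"
proof -
  have pos: "0 < x" "0 < y"
    using RLT_box[OF RLT_of_in_hull[OF assms]] lx_pos ly_pos by auto
  have z: "0 < z" using bounds_of_in_hull[OF assms] l_pos by simp
  \<comment> \<open>The parameter for which AM-GM is an equality at the given point.\<close>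
  define a where "a = sqrt x / sqrt y"
  have a: "0 < a" using pos by (simp add: a_def)
  have a2: "a\<^sup>2 * y = x" using pos by (simp add: a_def power_divide)
  have xa: "x = a * sqrt (x * y)" using pos by (simp add: a_def real_sqrt_mult)
  have "2 * a * (z + sqrt (l * u)) \<le> (sqrt l + sqrt u) * (2 * x)"
    using SOC1_plane[OF assms a] a2 by simp
  also have "\<dots> = 2 * a * ((sqrt l + sqrt u) * sqrt (x * y))" by (subst xa) simp
  finally have "z + sqrt (l * u) \<le> (sqrt l + sqrt u) * sqrt (x * y)"
    using a by simp
  then have "(z + sqrt (l * u))\<^sup>2 \<le> ((sqrt l + sqrt u) * sqrt (x * y))\<^sup>2"
    using z l_pos l_u by (intro power_mono) auto
  then show ?thesis using pos by (simp add: SOC1_def power_mult_distrib)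
qed

text \<open>For \<open>z \<ge> l\<close> the left-hand side of the constraint is increasing in
  \<open>z\<close>, and at \<open>z = l\<close> it equals
  \<open>(sqrt l + sqrt u)\<^sup>2 * l\<close>.\<close>

lemma SOC1_product_ge:
  assumes "SOC1 l u x y z" "l \<le> z"
  shows "l \<le> x * y"
proof -
  let ?k = "sqrt l + sqrt u"
  have k: "0 < ?k\<^sup>2" using l_pos l_u by (intro zero_less_power add_pos_pos) auto
  have "?k\<^sup>2 * l = (l + sqrt (l * u))\<^sup>2"
  proof -
    have "?k * sqrt l = l + sqrt (l * u)"
      using l_pos l_u by (simp add: real_sqrt_mult algebra_simps)
    then have "(?k * sqrt l)\<^sup>2 = (l + sqrt (l * u))\<^sup>2" by simp
    then show ?thesis using l_pos by (simp add: power_mult_distrib)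
  qed
  also have "\<dots> \<le> (z + sqrt (l * u))\<^sup>2"
    using assms(2) l_pos l_u by (intro power_mono) auto
  also have "\<dots> \<le> ?k\<^sup>2 * (x * y)" using assms(1) by (simp add: SOC1_def)
  finally show ?thesis using k by simp
qed

text \<open>The plane through the apex \<open>(m, ly, l)\<close> that is tangent to the upper hyperbola at
  \<open>(a, u / a, u)\<close>.\<close>

lemma SOC2_plane:
  assumes "in_hull x y z" and a: "l * u \<le> (ly * a)\<^sup>2" and m: "l = m * ly"
  shows "(2 * u * a - u * m - ly * a\<^sup>2) * (z - l) \<le> (u - l) * (u * (x - m) + a\<^sup>2 * (y - ly))"
proof -
  let ?D = "2 * u * a - u * m - ly * a\<^sup>2"
  have "(- (u - l) * u) * x + (- (u - l) * a\<^sup>2) * y + ?D * z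
      \<le> ?D * l - (u - l) * (u * m + a\<^sup>2 * ly)"
  proof (rule in_hull_linear_bound[OF assms(1)])
    fix x y assume f: "feasible x y"
    \<comment> \<open>The slack of the plane at a point of the surface.\<close>
    define G where "G = (u - l) * (u * (x - m) + a\<^sup>2 * (y - ly)) - ?D * (x * y - l)"
    have yly: "0 \<le> y - ly" using f by (simp add: feasible_def)
    have "0 \<le> G"
    proof (cases "m \<le> x")
      case True
      \<comment> \<open>A certificate with nonnegative terms: they vanish both at the apex and at
        the tangent point \<open>(a, u / a)\<close>.\<close>
      have id: "(u - ly * x) * G
          = (u - x * y) * ((x - m) * (u - ly * a)\<^sup>2) + (y - ly) * ((u - l) * u * (x - a)\<^sup>2)"
        unfolding G_def m by (simp add: power2_eq_square algebra_simps)
      have "0 \<le> (u - x * y) * ((x - m) * (u - ly * a)\<^sup>2) + (y - ly) * ((u - l) * u * (x - a)\<^sup>2)"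
        using f True l_u l_pos yly
        by (intro add_nonneg_nonneg mult_nonneg_nonneg) (auto simp: feasible_def)
      then have prod: "0 \<le> (u - ly * x) * G" using id by simp
      have le: "ly * x \<le> x * y" using f lx_pos by (simp add: feasible_def mult.commute)
      show ?thesis
      proof (cases "ly * x < u")
        case True
        then show ?thesis using prod by (simp add: zero_le_mult_iff)
      next
        \<comment> \<open>The multiplier is then zero, which forces \<open>y = ly\<close>; there the
          slack is computed directly.\<close>
        case False
        moreover have "x * y \<le> u" using f by (simp add: feasible_def)
        ultimately have "x * ly = x * y" using le mult.commute[of ly x] by linarith
        moreover have "0 < x" using f lx_pos by (simp add: feasible_def)
        ultimately have y: "y = ly" by simp
        have "G = (x - m) * (u - ly * a)\<^sup>2"
          unfolding G_def m y by (simp add: power2_eq_square algebra_simps)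
        then show ?thesis using \<open>m \<le> x\<close> by simp
      qed
    next
      case False
      \<comment> \<open>On the other side of the apex, the bound on \<open>ly * a\<close> makes the
        last term nonnegative.\<close>
      have id: "ly * (ly * G) = ly * ((x * y - l) * (u - ly * a)\<^sup>2)
          + ly * (u * (u - l) * (m - x) * (y - ly))
          + (y - ly) * (u - l) * ((ly * a)\<^sup>2 - l * u)"
        unfolding G_def m by (simp add: power2_eq_square algebra_simps)
      have "0 \<le> ly * ((x * y - l) * (u - ly * a)\<^sup>2) + ly * (u * (u - l) * (m - x) * (y - ly))
          + (y - ly) * (u - l) * ((ly * a)\<^sup>2 - l * u)"
        using f False l_u l_pos yly ly_pos a
        by (intro add_nonneg_nonneg mult_nonneg_nonneg) (auto simp: feasible_def)
      then have "0 \<le> ly * (ly * G)" using id by simp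
      then show ?thesis using ly_pos by (simp add: zero_le_mult_iff)
    qed
    then show "(- (u - l) * u) * x + (- (u - l) * a\<^sup>2) * y + ?D * (x * y)
        \<le> ?D * l - (u - l) * (u * m + a\<^sup>2 * ly)"
      unfolding G_def by (simp add: algebra_simps)
  qed
  then show ?thesis by (simp add: algebra_simps)
qed

text \<open>In relative coordinates \<open>P\<close>, \<open>Q\<close> from the apex the region says
  \<open>Q \<le> P\<close>, hence \<open>?B \<le> ?A\<close>, and the goal is
  \<open>u * W\<^sup>2 \<le> l * (?A * ?B)\<close>. If \<open>sqrt u * W \<le> sqrt l * ?B\<close>,
  this ordering suffices; otherwise the extremal plane satisfies the side condition of
  \<open>SOC2_plane\<close>.\<close>

lemma SOC2_of_in_hull:
  assumes h: "in_hull x y z" and reg: "y \<le> ly\<^sup>2 / l * x"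
  shows "SOC2 ly l u x y z"
proof -
  define m where "m = l / ly"
  have m: "l = m * ly" and m0: "0 < m" using ly_pos l_pos by (auto simp: m_def)
  define W where "W = z - l"
  have W: "0 \<le> W" using bounds_of_in_hull[OF h] by (simp add: W_def)
  define P Q where "P = (x - m) / m" and "Q = (y - ly) / ly"
  have Peq: "x - m = m * P" and Qeq: "y - ly = ly * Q" using m0 ly_pos by (auto simp: P_def Q_def)
  have Q0: "0 \<le> Q"
    using RLT_box[OF RLT_of_in_hull[OF h]] ly_pos by (simp add: Q_def)
  have "y \<le> ly / m * x" using reg ly_pos m0 by (simp add: m power2_eq_square)
  then have "m * y \<le> ly * x" using m0 by (simp add: field_simps)
  moreover have "y = ly + ly * Q" "x = m + m * P" using Peq Qeq by auto
  ultimately have "m * ly * Q \<le> m * ly * P" by (simp add: algebra_simps)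
  then have PQ: "Q \<le> P" using m0 ly_pos by simp
  let ?B = "(u - l) * Q + W" and ?A = "(u - l) * P + W"
  have AB: "0 \<le> ?B" "?B \<le> ?A" using PQ Q0 W l_u by (auto intro!: mult_left_mono)
  have goal: "u * W\<^sup>2 \<le> l * (?A * ?B)"
  proof (cases "sqrt u * W \<le> sqrt l * ?B")
    case True
    have "u * W\<^sup>2 = (sqrt u * W)\<^sup>2" using l_pos l_u by (simp add: power_mult_distrib)
    also have "\<dots> \<le> (sqrt l * ?B)\<^sup>2" using True W l_pos l_u by (intro power_mono) auto
    also have "\<dots> = l * (?B * ?B)" using l_pos by (simp add: power_mult_distrib power2_eq_square)
    also have "\<dots> \<le> l * (?A * ?B)"
      using AB l_pos by (intro mult_left_mono mult_right_mono) auto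
    finally show ?thesis .
  next
    case False
    show ?thesis
    proof (cases "?B = 0")
      case True
      then have "W = 0" using W Q0 l_u by (smt (verit) mult_nonneg_nonneg)
      then show ?thesis using AB l_pos by simp
    next
      case B: False
      \<comment> \<open>The tangent plane whose coefficient vector is extremal for the given point.\<close>
      define a where "a = u * W / (ly * ?B)"
      have Bp: "0 < ?B" using AB B by simp
      have lya: "ly * a = u * W / ?B" using ly_pos by (simp add: a_def)
      have "sqrt u * (sqrt l * ?B) \<le> sqrt u * (sqrt u * W)"
        using False l_pos l_u by (intro mult_left_mono) auto
      moreover have "sqrt u * (sqrt u * W) = u * W" using l_pos l_u by (simp flip: mult.assoc)
      ultimately have "sqrt (l * u) * ?B \<le> u * W" unfolding real_sqrt_mult by (metis mult.assoc mult.commute)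
      then have "sqrt (l * u) \<le> ly * a" using Bp by (simp add: lya pos_le_divide_eq)
      then have "(sqrt (l * u))\<^sup>2 \<le> (ly * a)\<^sup>2" using l_pos l_u by (intro power_mono) auto
      then have "l * u \<le> (ly * a)\<^sup>2" using l_pos l_u by simp
      from SOC2_plane[OF h this m]
      have "(2 * u * a - u * m - ly * a\<^sup>2) * W \<le> (u - l) * (u * (m * P) + a\<^sup>2 * (ly * Q))"
        by (simp add: W_def Peq Qeq)
      then have "2 * u * a * W \<le> u * m * ?A + ly * a\<^sup>2 * ?B" by (simp add: algebra_simps)
      then have "ly * (2 * u * a * W) \<le> ly * (u * m * ?A + ly * a\<^sup>2 * ?B)"
        using ly_pos by (intro mult_left_mono) auto
      \<comment> \<open>A quadratic inequality in \<open>ly * a\<close>; its slack is minimal at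
        \<open>ly * a = u * W / ?B\<close>, the value chosen above.\<close>
      then have "2 * u * W * (ly * a) \<le> u * l * ?A + (ly * a)\<^sup>2 * ?B"
        unfolding m by (simp add: algebra_simps power2_eq_square)
      then have "?B * (2 * u * W * (ly * a)) \<le> ?B * (u * l * ?A + (ly * a)\<^sup>2 * ?B)"
        using Bp by (intro mult_left_mono) auto
      then have "2 * u * W * (?B * (ly * a)) \<le> u * l * (?A * ?B) + (?B * (ly * a))\<^sup>2"
        by (simp add: algebra_simps power2_eq_square)
      moreover have lya': "?B * (ly * a) = u * W" using Bp by (simp add: lya)
      ultimately have "2 * u * W * (u * W) \<le> u * l * (?A * ?B) + (u * W)\<^sup>2"
        unfolding lya' by simp
      then have "u * (u * W\<^sup>2) \<le> u * (l * (?A * ?B))"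
        by (simp add: power2_eq_square algebra_simps)
      then show ?thesis using l_pos l_u by simp
    qed
  qed
  have "l * (?A * ?B) = ((u - l) * (x - l / ly) + l / ly * (z - l)) * ((u - l) * (y - ly) + ly * (z - l))"
    unfolding m_def[symmetric] Peq Qeq W_def[symmetric] by (subst (1) m) (simp add: algebra_simps)
  then show ?thesis using goal ly_pos by (simp add: SOC2_iff W_def)
qed

text \<open>The plane through the apex \<open>(u, 1, u)\<close> that is tangent to the lower hyperbola at
  \<open>(a, l / a, l)\<close>.\<close>

lemma SOC3_plane:
  assumes "in_hull x y z" and a: "a\<^sup>2 \<le> l * u"
  shows "(u - l) * (l * (u - x) + a\<^sup>2 * (1 - y)) \<le> (a\<^sup>2 - 2 * a * l + u * l) * (u - z)"
proof -
  let ?D = "a\<^sup>2 - 2 * a * l + u * l"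
  have "(- (u - l) * l) * x + (- (u - l) * a\<^sup>2) * y + ?D * z \<le> ?D * u - (u - l) * (l * u + a\<^sup>2)"
  proof (rule in_hull_linear_bound[OF assms(1)])
    fix x y assume f: "feasible x y"
    define G where "G = ?D * (u - x * y) - (u - l) * (l * (u - x) + a\<^sup>2 * (1 - y))"
    have x: "l \<le> x" "0 < x" using f l_lx l_pos by (auto simp: feasible_def)
    have y: "0 \<le> 1 - y" using f by (simp add: feasible_def)
    have "0 \<le> G"
    proof (cases "x \<le> u")
      case True
      \<comment> \<open>Again a certificate vanishing at the apex and at the tangent point
        \<open>(a, l / a)\<close>. The multiplier is zero only for \<open>x = l\<close>, where
        \<open>y = 1\<close>.\<close>
      have id: "(x - l) * G = (x * y - l) * ((u - x) * (a - l)\<^sup>2) + (1 - y) * ((u - l) * l * (x - a)\<^sup>2)"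
        unfolding G_def by (simp add: power2_eq_square algebra_simps)
      have "0 \<le> (x * y - l) * ((u - x) * (a - l)\<^sup>2) + (1 - y) * ((u - l) * l * (x - a)\<^sup>2)"
        using f True l_u l_pos y
        by (intro add_nonneg_nonneg mult_nonneg_nonneg) (auto simp: feasible_def)
      then have prod: "0 \<le> (x - l) * G" using id by simp
      show ?thesis
      proof (cases "x = l")
        case True
        then have "1 \<le> y" using f l_pos by (simp add: feasible_def)
        then have y1: "y = 1" using y by simp
        have "G = (u - x) * (a - l)\<^sup>2"
          unfolding G_def y1 by (simp add: power2_eq_square algebra_simps)
        then show ?thesis using \<open>x \<le> u\<close> by simp
      next
        case False
        then show ?thesis using prod x by (simp add: zero_le_mult_iff)
      qed
    next
      case False
      \<comment> \<open>Beyond the apex, the last term is nonnegative because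
        \<open>a\<^sup>2 \<le> l * u\<close>.\<close>
      have id: "G = (u - x * y) * (a - l)\<^sup>2 + (x - u) * (1 - y) * (l * (u - l)) + (1 - y) * ((u - l) * (l * u - a\<^sup>2))"
        unfolding G_def by (simp add: power2_eq_square algebra_simps)
      show ?thesis unfolding id
        using f False l_u l_pos y a
        by (intro add_nonneg_nonneg mult_nonneg_nonneg) (auto simp: feasible_def)
    qed
    then show "(- (u - l) * l) * x + (- (u - l) * a\<^sup>2) * y + ?D * (x * y) \<le> ?D * u - (u - l) * (l * u + a\<^sup>2)"
      unfolding G_def by (simp add: algebra_simps)
  qed
  then show ?thesis by (simp add: algebra_simps)
qed

text \<open>Being at least the larger root means two things: \<open>w\<close> is not left of the
  vertex (\<open>w2\<close>), and the quadratic is nonnegative at \<open>w\<close>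
  (\<open>key\<close>). The plane for \<open>a = sqrt (l * u)\<close> gives the first and shows that
  the extremal \<open>a\<close> is admissible; the plane for that \<open>a\<close> gives the
  second.\<close>

lemma SOC3_of_in_hull:
  assumes h: "in_hull x y z" and reg: "x \<le> u * y"
  shows "SOC3 l u x y z"
proof -
  define p q w where "p = u - x" and "q = 1 - y" and "w = u - z"
  have q: "0 \<le> q" using RLT_box[OF RLT_of_in_hull[OF h]] by (simp add: q_def)
  have w: "0 \<le> w" using bounds_of_in_hull[OF h] by (simp add: w_def)
  have pq: "u * q \<le> p" using reg by (simp add: p_def q_def algebra_simps)
  define r s where "r = sqrt l" and "s = sqrt u"
  have rs: "0 < r" "r < s" "l = r * r" "u = s * s" using l_pos l_u by (auto simp: r_def s_def)
  have plane: "(u - l) * (l * p + a\<^sup>2 * q) \<le> (a\<^sup>2 - 2 * a * l + u * l) * w" if "a\<^sup>2 \<le> l * u" for a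
    using SOC3_plane[OF h that] by (simp add: p_def q_def w_def)
  \<comment> \<open>The boundary member of the family,
    \<open>a = r * s = sqrt (l * u)\<close>.\<close>
  have "(u - l) * (l * p + (r * s)\<^sup>2 * q) \<le> ((r * s)\<^sup>2 - 2 * (r * s) * l + u * l) * w"
    by (rule plane) (simp add: rs power2_eq_square algebra_simps)
  then have "(r * r * (s - r)) * ((s + r) * (p + u * q)) \<le> (r * r * (s - r)) * (2 * s * w)"
    by (simp add: rs power2_eq_square algebra_simps)
  then have e1: "(s + r) * (p + u * q) \<le> 2 * s * w" using rs by simp
  have "s * (p + u * q) \<le> (s + r) * (p + u * q)"
    using rs pq q by (intro mult_right_mono add_nonneg_nonneg) (auto intro: order_trans[rotated])
  then have "s * (p + u * q) \<le> s * (2 * w)" using e1 by simp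
  then have w2: "p + u * q \<le> 2 * w" using rs by simp
  have "(s + r) * (2 * (s * s * q)) \<le> (s + r) * (p + u * q)"
    using rs pq by (intro mult_left_mono) (auto simp: mult.commute)
  then have "2 * s * ((s + r) * s * q) \<le> 2 * s * w" using e1 by (simp add: algebra_simps)
  then have e2: "(s + r) * s * q \<le> w" using rs by simp
  let ?B = "w - (u - l) * q"
  have Bq: "r * w \<le> s * ?B"
  proof -
    have "(s - r) * ((s + r) * s * q) \<le> (s - r) * w" using e2 rs by (intro mult_left_mono) auto
    then show ?thesis by (simp add: rs algebra_simps)
  qed
  have key: "0 \<le> w\<^sup>2 - w * (p + u * q) + (u - l) * (p * q)"
  proof (cases "w = 0")
    case True
    then have "p + u * q \<le> 0" "0 \<le> u * q" using w2 q rs by auto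
    then have "p = 0" using pq by linarith
    then show ?thesis using True by simp
  next
    case False
    then have "0 < r * w" using w rs by simp
    then have Bp: "0 < ?B" using Bq rs by (smt (verit) zero_less_mult_pos)
    \<comment> \<open>The plane inequality is quadratic in \<open>a\<close> with leading coefficient
      \<open>?B\<close>; this \<open>a\<close> minimizes its slack. By \<open>Bq\<close> it is at
      most \<open>r * s\<close>.\<close>
    define a where "a = l * w / ?B"
    have a: "?B * a = l * w" using Bp by (simp add: a_def)
    have a0: "0 \<le> a" using Bp w l_pos by (simp add: a_def)
    have "r * (r * w) \<le> r * (s * ?B)" using Bq rs by (intro mult_left_mono) auto
    then have "a \<le> r * s" using Bp by (simp add: a_def rs pos_divide_le_eq algebra_simps)
    then have "a\<^sup>2 \<le> (r * s)\<^sup>2" using a0 by (intro power_mono)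
    then have "a\<^sup>2 \<le> l * u" by (simp add: rs power2_eq_square algebra_simps)
    from plane[OF this] have "2 * a * l * w \<le> a\<^sup>2 * ?B + l * (u * w - (u - l) * p)"
      by (simp add: algebra_simps)
    then have "?B * (2 * a * l * w) \<le> ?B * (a\<^sup>2 * ?B + l * (u * w - (u - l) * p))"
      using Bp by (intro mult_left_mono) auto
    also have "\<dots> = (?B * a)\<^sup>2 + l * (?B * (u * w - (u - l) * p))"
      by (simp add: algebra_simps power2_eq_square)
    also have "?B * (2 * a * l * w) = 2 * (?B * a) * (l * w)" by simp
    finally have "2 * (?B * a) * (l * w) \<le> (?B * a)\<^sup>2 + l * (?B * (u * w - (u - l) * p))" .
    then have "l * (l * w\<^sup>2) \<le> l * (?B * (u * w - (u - l) * p))"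
      unfolding a by (simp add: power2_eq_square algebra_simps)
    then have "l * w\<^sup>2 \<le> ?B * (u * w - (u - l) * p)" using l_pos by simp
    then have "0 \<le> (u - l) * (w\<^sup>2 - w * (p + u * q) + (u - l) * (p * q))"
      by (simp add: power2_eq_square algebra_simps)
    then show ?thesis using l_u by (simp add: zero_le_mult_iff)
  qed
  have "sqrt ((p + u * q)\<^sup>2 - 4 * (u - l) * (p * q)) \<le> 2 * w - (p + u * q)"
  proof (rule real_le_lsqrt)
    show "0 \<le> 2 * w - (p + u * q)" using w2 by simp
    show "(p + u * q)\<^sup>2 - 4 * (u - l) * (p * q) \<le> (2 * w - (p + u * q))\<^sup>2"
      using key by (simp add: power2_eq_square algebra_simps)
  qed
  then show ?thesis by (simp add: SOC3_iff p_def q_def w_def)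
qed


section \<open>Sufficiency: axis-parallel segments and the top face\<close>

lemma in_hull_between_x:
  assumes "in_hull x1 y z" "in_hull x2 y z" "x1 \<le> x" "x \<le> x2"
  shows "in_hull x y z"
proof (cases "x1 = x2")
  case True
  then show ?thesis using assms by simp
next
  case False
  define t where "t = (x - x1) / (x2 - x1)"
  have "t * (x2 - x1) = x - x1" "0 \<le> t" "t \<le> 1"
    using assms(3,4) False by (auto simp: t_def field_simps)
  then show ?thesis
    by (intro in_hull_mix[OF assms(1,2), of t]) (auto simp: algebra_simps)
qed

lemma in_hull_between_z:
  assumes "in_hull x y z1" "in_hull x y z2" "z1 \<le> z" "z \<le> z2"
  shows "in_hull x y z"
proof (cases "z1 = z2")
  case True
  then show ?thesis using assms by simp
next
  case False
  define t where "t = (z - z1) / (z2 - z1)"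
  have "t * (z2 - z1) = z - z1" "0 \<le> t" "t \<le> 1"
    using assms(3,4) False by (auto simp: t_def field_simps)
  then show ?thesis
    by (intro in_hull_mix[OF assms(1,2), of t]) (auto simp: algebra_simps)
qed

text \<open>At fixed \<open>y\<close>, the point lies between the hyperbola at \<open>u / y\<close>
  and the chord \<open>x + y = 1 + u\<close> joining \<open>(1, u)\<close> to
  \<open>(u, 1)\<close>.\<close>

lemma in_hull_level_u:
  assumes "u \<le> x * y" "0 \<le> x" "x \<le> 1" "y \<le> 1" "x + y \<le> 1 + u"
  shows "in_hull x y u"
proof -
  have "x * y \<le> 1 * y"
    using assms l_pos l_u by (intro mult_right_mono) (auto, smt (verit) mult_nonneg_nonpos)
  then have y: "u \<le> y" "0 < y" using assms l_pos l_u by auto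
  have "in_hull (u / y) y u"
  proof (rule in_hull_product)
    have "u * y \<le> u * 1" using assms l_pos l_u by (intro mult_left_mono) auto
    then have "u \<le> u / y" using y by (simp add: field_simps)
    then show "feasible (u / y) y"
      using y assms lx_u ly_u l_u by (auto simp: feasible_def)
  qed (use y in simp)
  moreover have "in_hull (1 + u - y) y u"
  proof (rule in_hull_mix[where t = "(y - u) / (1 - u)"])
    show "in_hull 1 u u" "in_hull u 1 u"
      using lx_u ly_u l_u u_1 by (auto intro!: in_hull_product simp: feasible_def)
    show "0 \<le> (y - u) / (1 - u)" "(y - u) / (1 - u) \<le> 1"
      using y assms u_1 by auto
    define t where "t = (y - u) / (1 - u)"
    have "y = u + t * (1 - u)" using u_1 by (simp add: t_def)
    then show "1 + u - y = (1 - (y - u) / (1 - u)) * 1 + (y - u) / (1 - u) * u"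
      "y = (1 - (y - u) / (1 - u)) * u + (y - u) / (1 - u) * 1"
      "u = (1 - (y - u) / (1 - u)) * u + (y - u) / (1 - u) * u"
      unfolding t_def[symmetric] by (simp_all add: algebra_simps)
  qed
  ultimately show ?thesis
    by (rule in_hull_between_x) (use assms y in \<open>auto simp: field_simps\<close>)
qed

section \<open>Hull points above, one lemma for each cone constraint\<close>

text \<open>This is the point with product \<open>k\<^sup>2\<close> on the ray
  \<open>x = c\<^sup>2 * y\<close>. The bounds on \<open>c\<close> describe the region of the first
  constraint and give \<open>ly \<le> k / c \<le> 1\<close>; combined with region C they also give
  \<open>lx \<le> k * c \<le> 1\<close>.\<close>

lemma feasible_radial:
  assumes "0 < c" "u \<le> c\<^sup>2" "ly\<^sup>2 * c\<^sup>2 \<le> l" "0 < k" "l \<le> k\<^sup>2" "k\<^sup>2 \<le> u"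
  shows "feasible (k * c) (k / c)"
proof -
  have "l * u \<le> k\<^sup>2 * c\<^sup>2" using assms l_pos l_u by (intro mult_mono) auto
  then have "lx\<^sup>2 \<le> (k * c)\<^sup>2" using lx_sq by (simp add: power_mult_distrib)
  then have "lx \<le> k * c" by (rule power2_le_imp_le) (use assms in auto)
  moreover have "ly\<^sup>2 * (k * c)\<^sup>2 \<le> ly\<^sup>2 * 1"
  proof -
    have "(ly\<^sup>2 * c\<^sup>2) * k\<^sup>2 \<le> l * u" using assms l_pos l_u by (intro mult_mono) auto
    then show ?thesis using ly_sq_ge by (simp add: power_mult_distrib ac_simps)
  qed
  then have "(k * c)\<^sup>2 \<le> 1\<^sup>2" using ly_pos by simp
  then have "k * c \<le> 1" by (rule power2_le_imp_le) simp
  moreover have "(ly * c)\<^sup>2 \<le> k\<^sup>2" using assms by (simp add: power_mult_distrib)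
  then have "ly * c \<le> k" by (rule power2_le_imp_le) (use assms in auto)
  then have "ly \<le> k / c" using assms by (simp add: pos_le_divide_eq)
  moreover have "k\<^sup>2 \<le> c\<^sup>2" using assms by linarith
  then have "k \<le> c" by (rule power2_le_imp_le) (use assms in auto)
  then have "k / c \<le> 1" using assms by simp
  moreover have "k * c * (k / c) = k\<^sup>2" using assms by (simp add: power2_eq_square)
  ultimately show ?thesis using assms unfolding feasible_def by simp
qed

text \<open>The radial segment through \<open>(x, y)\<close> between the hyperbolas is linear in
  \<open>s = sqrt (x * y)\<close>. Its height is \<open>(r + v) * s - r * v\<close>, which is
  exactly the bound that the constraint puts on \<open>z\<close>.\<close>

lemma ex_in_hull_above_SOC1:
  assumes pos: "0 < x" "0 < y" and reg: "ly\<^sup>2 / l * x \<le> y" "y \<le> x / u"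
    and soc: "SOC1 l u x y z" and z: "l \<le> z" and xy: "x * y \<le> u"
  shows "\<exists>Z\<ge>z. in_hull x y Z"
proof -
  define c where "c = sqrt (x / y)"
  have c: "0 < c" "c\<^sup>2 = x / y" using pos by (auto simp: c_def)
  have cu: "u \<le> c\<^sup>2" using reg(2) pos l_pos l_u unfolding c by (simp add: field_simps)
  have cl: "ly\<^sup>2 * c\<^sup>2 \<le> l" using reg(1) pos l_pos unfolding c by (simp add: field_simps)
  define s where "s = sqrt (x * y)"
  have s: "x = s * c" "y = s / c"
    using pos by (auto simp: s_def c_def real_sqrt_mult real_sqrt_divide)
  define r v where "r = sqrt l" and "v = sqrt u"
  have rv: "0 < r" "r < v" "r\<^sup>2 = l" "v\<^sup>2 = u" using l_pos l_u by (auto simp: r_def v_def)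
  have s_bounds: "r \<le> s" "s \<le> v"
    using SOC1_product_ge[OF soc z] xy by (auto simp: r_def v_def s_def)
  define t where "t = (s - r) / (v - r)"
  have t: "0 \<le> t" "t \<le> 1" using s_bounds rv by (auto simp: t_def)
  have st: "s = (1 - t) * r + t * v"
  proof -
    have "t * (v - r) = s - r" using rv by (simp add: t_def)
    then show ?thesis by (simp add: algebra_simps)
  qed
  have "in_hull x y ((1 - t) * r\<^sup>2 + t * v\<^sup>2)"
  proof (rule in_hull_mix[OF _ _ t])
    show "in_hull (r * c) (r / c) (r\<^sup>2)" "in_hull (v * c) (v / c) (v\<^sup>2)"
      using feasible_radial[OF c(1) cu cl, of r] feasible_radial[OF c(1) cu cl, of v] rv c l_u
      by (simp_all add: in_hull_product power2_eq_square)
  qed (use c in \<open>auto simp: s st field_simps\<close>)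
  moreover have "(1 - t) * r\<^sup>2 + t * v\<^sup>2 = (r + v) * s - r * v"
    unfolding st by (simp add: power2_eq_square algebra_simps)
  moreover have "z \<le> (r + v) * s - r * v"
  proof -
    have "(z + r * v)\<^sup>2 \<le> ((r + v) * s)\<^sup>2"
      using soc pos by (simp add: SOC1_def r_def v_def s_def real_sqrt_mult power_mult_distrib)
    moreover have "0 \<le> (r + v) * s" using rv s_bounds by simp
    ultimately have "z + r * v \<le> (r + v) * s" by (rule power2_le_imp_le)
    then show ?thesis by simp
  qed
  ultimately show ?thesis by auto
qed

text \<open>If the ray from the apex reaches the upper hyperbola with \<open>b \<le> 1\<close>, the
  segment to it has height \<open>(1 - t) * l + t * u\<close>, the bound of the cone constraint. If
  it crosses \<open>x = 1\<close> first, the segment to that crossing lies in the facet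
  \<open>z = ly * x + y - ly\<close>.\<close>

lemma ex_in_hull_above_SOC2:
  assumes rlt: "RLT lx ly x y z" and reg: "y \<le> ly\<^sup>2 / l * x"
    and soc: "SOC2 ly l u x y z" and z: "l \<le> z" and xy: "x * y \<le> u"
  shows "\<exists>Z\<ge>z. in_hull x y Z"
proof -
  define m where "m = l / ly"
  have m: "l = m * ly" and m0: "0 < m" using ly_pos l_pos by (auto simp: m_def)
  have m1: "m < 1" using l_less_ly ly_pos by (simp add: m_def)
  have m_lx: "lx \<le> m" using lx_ly ly_pos by (simp add: m_def pos_le_divide_eq)
  note box = RLT_box[OF rlt]
  have slope: "m * y \<le> ly * x"
    using reg ly_pos m0 by (simp add: m power2_eq_square field_simps)
  have apex: "in_hull m ly l"
    using m_lx m1 ly_u u_1 l_u by (intro in_hull_product) (simp_all add: feasible_def flip: m)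
  define P Q where "P = x - m" and "Q = y - ly"
  have Q: "0 \<le> Q" using box by (simp add: Q_def)
  have "ly * m \<le> ly * x"
    using slope box m0 by (smt (verit) mult.commute mult_left_mono)
  then have P: "0 \<le> P" using ly_pos by (simp add: P_def)
  have slopePQ: "m * Q \<le> ly * P" using slope by (simp add: P_def Q_def algebra_simps)
  define B where "B = m * Q + ly * P"
  have B: "0 \<le> B" using P Q m0 ly_pos by (simp add: B_def)
  have xyl: "x * y - l = B + P * Q" by (simp add: B_def P_def Q_def m algebra_simps)
  \<comment> \<open>\<open>(b, c) = (m + P / t, ly + Q / t)\<close> is where the ray from the apex meets the upper hyperbola.\<close>
  define t where "t = (B + sqrt (B\<^sup>2 + 4 * (u - l) * (P * Q))) / (2 * (u - l))"
  have PQ0: "0 \<le> 4 * (u - l) * (P * Q)" using P Q l_u by simp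
  have t2: "2 * (u - l) * t - B = sqrt (B\<^sup>2 + 4 * (u - l) * (P * Q))"
    using l_u by (simp add: t_def)
  then have "(2 * (u - l) * t - B)\<^sup>2 = B\<^sup>2 + 4 * (u - l) * (P * Q)" using PQ0 by simp
  then have "(4 * (u - l)) * ((u - l) * t\<^sup>2) = (4 * (u - l)) * (t * B + P * Q)"
    by (simp add: power2_eq_square algebra_simps)
  then have root: "(u - l) * t\<^sup>2 = t * B + P * Q" using l_u by simp
  have t0: "0 \<le> t" using B PQ0 l_u by (simp add: t_def)
  show ?thesis
  proof (cases "t = 0")
    case True
    then have "- B = sqrt (B\<^sup>2 + 4 * (u - l) * (P * Q))" using t2 by simp
    moreover have "0 \<le> sqrt (B\<^sup>2 + 4 * (u - l) * (P * Q))" using PQ0 by simp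
    ultimately have "B \<le> 0" by linarith
    then have "m * Q = 0" "ly * P = 0" using P Q m0 ly_pos unfolding B_def
      by (smt (verit) mult_nonneg_nonneg)+
    then have "x = m" "y = ly" using m0 ly_pos by (auto simp: P_def Q_def)
    moreover have "z \<le> l" using rlt unfolding RLT_def \<open>x = m\<close> \<open>y = ly\<close> m by (simp add: mult.commute)
    ultimately show ?thesis using apex by auto
  next
    case False
    then have tp: "0 < t" using t0 by simp
    have t1: "t \<le> 1"
    proof (rule ccontr)
      assume "\<not> t \<le> 1"
      then have "1 * (P * Q) \<le> t * (P * Q)" using P Q by (intro mult_right_mono) auto
      then have "(u - l) * t\<^sup>2 \<le> t * (B + P * Q)" using root by (simp add: algebra_simps)
      also have "\<dots> \<le> t * (u - l)" using xy xyl tp by (intro mult_left_mono) auto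
      finally have "(u - l) * t * t \<le> (u - l) * t * 1" by (simp add: power2_eq_square algebra_simps)
      then show False using \<open>\<not> t \<le> 1\<close> l_u tp by simp
    qed
    define b c where "b = m + P / t" and "c = ly + Q / t"
    have Pt: "P = t * (b - m)" and Qt: "Q = t * (c - ly)" using tp by (auto simp: b_def c_def)
    have "t\<^sup>2 * (b * c) = t\<^sup>2 * u"
    proof -
      have "t\<^sup>2 * (b * c - l) = t * B + P * Q"
        unfolding B_def Pt Qt m by (simp add: power2_eq_square algebra_simps)
      then show ?thesis using root by (simp add: algebra_simps)
    qed
    then have bc: "b * c = u" using tp by simp
    have bm: "m \<le> b" and cly: "ly \<le> c" using P Q tp by (auto simp: b_def c_def)
    have b0: "0 < b" and c0: "0 < c" using bm cly m0 ly_pos by auto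
    show ?thesis
    proof (cases "b \<le> 1")
      case True
      \<comment> \<open>The slope condition of the region, with \<open>b * c = u\<close> and
        \<open>ly\<^sup>2 * u \<le> l\<close>, keeps the end point below
        \<open>y = 1\<close>.\<close>
      have "t * (m * c) \<le> t * (ly * b)" using slopePQ unfolding Pt Qt by (simp add: algebra_simps)
      then have "m * c \<le> ly * b" using tp by simp
      then have "(ly * c) * (m * c) \<le> (ly * c) * (ly * b)"
        using ly_pos c0 by (intro mult_left_mono) auto
      also have "\<dots> = ly\<^sup>2 * (b * c)" by (simp add: power2_eq_square)
      also have "\<dots> \<le> l" using ly_sq_le bc by simp
      finally have "l * c\<^sup>2 \<le> l * 1" unfolding m by (simp add: power2_eq_square algebra_simps)
      then have "c\<^sup>2 \<le> 1\<^sup>2" using l_pos by simp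
      then have "c \<le> 1" by (rule power2_le_imp_le) simp
      then have "in_hull b c u"
        using True bm m_lx cly bc l_u by (intro in_hull_product) (auto simp: feasible_def)
      from in_hull_mix[OF apex this t0 t1 _ _ refl]
      have "in_hull x y ((1 - t) * l + t * u)"
        using Pt Qt by (simp add: P_def Q_def algebra_simps)
      moreover have "z \<le> (1 - t) * l + t * u"
      proof (rule ccontr)
        assume above: "\<not> z \<le> (1 - t) * l + t * u"
        \<comment> \<open>\<open>T\<close> is the positive root of
          \<open>X\<^sup>2 = (u - l) * (P * Q) + X * B\<close>, while the constraint gives
          \<open>\<le>\<close> for \<open>W\<close>. Hence \<open>W\<close> cannot exceed
          \<open>T\<close>.\<close>
        define W T where "W = z - l" and "T = (u - l) * t"
        have WT: "T < W" "0 < T"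
          using above tp l_u by (auto simp: W_def T_def algebra_simps)
        have "u * W\<^sup>2 \<le> ((u - l) * P + m * W) * ((u - l) * Q + ly * W)"
          using soc ly_pos by (simp add: SOC2_iff m_def P_def Q_def W_def)
        also have "\<dots> = (u - l) * ((u - l) * (P * Q) + W * B) + l * W\<^sup>2"
          unfolding m B_def by (simp add: power2_eq_square algebra_simps)
        finally have "(u - l) * W\<^sup>2 \<le> (u - l) * ((u - l) * (P * Q) + W * B)"
          by (simp add: algebra_simps)
        then have W2: "W\<^sup>2 \<le> (u - l) * (P * Q) + W * B" using l_u by simp
        have T2: "T\<^sup>2 = (u - l) * (P * Q) + T * B"
        proof -
          have "T\<^sup>2 = (u - l) * ((u - l) * t\<^sup>2)" by (simp add: T_def power2_eq_square)
          then show ?thesis unfolding root by (simp add: T_def algebra_simps)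
        qed
        have "T * W\<^sup>2 \<le> T * ((u - l) * (P * Q) + W * B)" using W2 WT by (intro mult_left_mono) auto
        also have "\<dots> \<le> W * ((u - l) * (P * Q)) + T * (W * B)"
          using WT P Q l_u by (simp add: distrib_left mult_right_mono)
        also have "\<dots> = W * T\<^sup>2" unfolding T2 by (simp add: algebra_simps)
        finally have "(T * W) * W \<le> (T * W) * T" by (simp add: power2_eq_square algebra_simps)
        then show False using WT by simp
      qed
      ultimately show ?thesis by auto
    next
      case False
      then have Pp: "0 < P" using m1 tp unfolding Pt by simp
      \<comment> \<open>Chosen so that \<open>m + P / \<sigma> = 1\<close>;
        \<open>t < \<sigma>\<close> says that the ray crosses \<open>x = 1\<close> before the
        hyperbola.\<close>
      define \<sigma> where "\<sigma> = P / (1 - m)"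
      have \<sigma>: "t < \<sigma>" "\<sigma> \<le> 1" "P = \<sigma> * (1 - m)"
      proof -
        have "t * (1 - m) < P" using False tp by (simp add: Pt)
        then show "t < \<sigma>" using m1 by (simp add: \<sigma>_def pos_less_divide_eq)
        show "\<sigma> \<le> 1" "P = \<sigma> * (1 - m)" using m1 box by (auto simp: \<sigma>_def P_def)
      qed
      define y2 where "y2 = ly + Q / \<sigma>"
      have Qs: "Q = \<sigma> * (y2 - ly)" using \<sigma> tp by (simp add: y2_def)
      have "c * 1 \<le> c * b" using False c0 by (intro mult_left_mono) auto
      then have "c \<le> u" using bc by (simp add: mult.commute)
      moreover have "y2 \<le> c" using \<sigma> tp Q by (simp add: y2_def c_def frac_le)
      moreover have "ly \<le> y2" using Q \<sigma> tp by (simp add: y2_def)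
      ultimately have "in_hull 1 y2 y2"
        using lx_u u_1 l_ly by (intro in_hull_product) (auto simp: feasible_def)
      from in_hull_mix[OF apex this _ \<sigma>(2) _ _ refl]
      have "in_hull x y ((1 - \<sigma>) * l + \<sigma> * y2)"
        using \<sigma> tp Qs by (simp add: P_def Q_def algebra_simps)
      moreover have "(1 - \<sigma>) * l + \<sigma> * y2 = ly * x + y - ly"
      proof -
        have "(1 - \<sigma>) * l + \<sigma> * y2 = m * ly + ly * (\<sigma> * (1 - m)) + \<sigma> * (y2 - ly)"
          unfolding m by (simp add: algebra_simps)
        also have "\<dots> = m * ly + ly * P + Q" by (simp flip: \<sigma>(3) Qs)
        finally show ?thesis by (simp add: P_def Q_def algebra_simps)
      qed
      moreover have "z \<le> ly * x + y - ly" using rlt by (simp add: RLT_def)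
      ultimately show ?thesis by auto
    qed
  qed
qed

text \<open>The number \<open>(u - l) * t\<close> is the larger root in \<open>SOC3_iff\<close>, so
  the constraint bounds \<open>z\<close> by the height of the segment from the apex to the lower
  hyperbola. If the ray crosses \<open>x = lx\<close> first, the segment to the crossing lies in the
  facet \<open>z = x + lx * y - lx\<close>.\<close>

lemma ex_in_hull_above_SOC3:
  assumes rlt: "RLT lx ly x y z" and reg: "x \<le> u * y"
    and soc: "SOC3 l u x y z" and z: "l \<le> z" "z \<le> u"
  shows "\<exists>Z\<ge>z. in_hull x y Z"
proof -
  note box = RLT_box[OF rlt]
  have apex: "in_hull u 1 u"
    using lx_u ly_u u_1 l_u by (intro in_hull_product) (auto simp: feasible_def)
  define p q where "p = u - x" and "q = 1 - y"
  have q: "0 \<le> q" using box by (simp add: q_def)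
  have pq: "u * q \<le> p" using reg by (simp add: p_def q_def algebra_simps)
  have p: "0 \<le> p" using pq q l_pos l_u by (smt (verit) mult_nonneg_nonneg)
  define S where "S = p + u * q"
  have S: "0 \<le> S" using p q l_pos l_u by (simp add: S_def)
  define d where "d = S\<^sup>2 - 4 * (u - l) * (p * q)"
  have "d = (p - u * q)\<^sup>2 + 4 * l * (p * q)"
    by (simp add: d_def S_def power2_eq_square algebra_simps)
  then have d: "0 \<le> d" using p q l_pos by simp
  \<comment> \<open>The larger root: the ray from the apex first meets the lower hyperbola at \<open>(u - p / t, 1 - q / t)\<close>.\<close>
  define t where "t = (S + sqrt d) / (2 * (u - l))"
  have t2: "2 * (u - l) * t - S = sqrt d" using l_u by (simp add: t_def)
  then have "(2 * (u - l) * t - S)\<^sup>2 = d" using d by simp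
  then have "(4 * (u - l)) * ((u - l) * t\<^sup>2) = (4 * (u - l)) * (t * S - p * q)"
    unfolding d_def by (simp add: power2_eq_square algebra_simps)
  then have root: "(u - l) * t\<^sup>2 = t * S - p * q" using l_u by simp
  have tS: "S \<le> 2 * (u - l) * t" using t2 d by (smt (verit) real_sqrt_ge_zero)
  have t0: "0 \<le> t" using S d l_u by (simp add: t_def)
  have "sqrt d \<le> 2 * (u - z) - S"
    using soc by (simp add: SOC3_iff d_def S_def p_def q_def)
  then have zt: "z \<le> u - (u - l) * t" using t2 by (simp add: algebra_simps)
  then have "(u - l) * t \<le> (u - l) * 1" using z by simp
  then have t1: "t \<le> 1" using l_u by simp
  show ?thesis
  proof (cases "t = 0")
    case True
    then have "S \<le> 0" using tS by simp
    moreover have "0 \<le> u * q" using q l_pos l_u by simp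
    ultimately have "p = 0" "u * q = 0" using p unfolding S_def by linarith+
    then have "x = u" "y = 1" using l_pos l_u by (auto simp: p_def q_def)
    then show ?thesis using apex z by auto
  next
    case False
    then have tp: "0 < t" using t0 by simp
    define b c where "b = u - p / t" and "c = 1 - q / t"
    have pt: "p = t * (u - b)" and qt: "q = t * (1 - c)" using tp by (auto simp: b_def c_def)
    have "t\<^sup>2 * (b * c) = t\<^sup>2 * l"
    proof -
      have "t\<^sup>2 * (u - b * c) = t * S - p * q"
        unfolding S_def pt qt by (simp add: power2_eq_square algebra_simps)
      then show ?thesis using root by (simp add: algebra_simps)
    qed
    then have bc: "b * c = l" using tp by simp
    \<comment> \<open>This gives \<open>c \<ge> 0\<close>, which selects the positive branch of
      \<open>b * c = l\<close>.\<close>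
    have "u * q \<le> u * t"
    proof -
      have "2 * (u * q) \<le> 2 * (u - l) * t" using tS pq by (simp add: S_def)
      also have "\<dots> \<le> 2 * (u * t)" using l_pos tp by (simp add: algebra_simps)
      finally show ?thesis by simp
    qed
    then have "q \<le> t" using l_pos l_u by simp
    then have "0 \<le> c" using tp by (simp add: c_def)
    then have c0: "0 < c" and b0: "0 < b"
      using zero_less_mult_iff[of b c] bc l_pos by auto
    have c1: "c \<le> 1" and bu: "b \<le> u" using p q tp by (auto simp: b_def c_def)
    \<comment> \<open>The region gives \<open>b \<le> u * c\<close>; with \<open>b * c = l\<close>
      and \<open>ly\<^sup>2 * u \<le> l\<close> this yields \<open>ly \<le> c\<close>.\<close>
    have "t * b \<le> t * (u * c)"
      using pq unfolding pt qt by (simp add: algebra_simps)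
    then have "b \<le> u * c" using tp by simp
    then have "b * c \<le> u * c * c" using c0 by (intro mult_right_mono) auto
    then have "u * ly\<^sup>2 \<le> u * c\<^sup>2" using ly_sq_le bc by (simp add: power2_eq_square ac_simps)
    then have "ly\<^sup>2 \<le> c\<^sup>2" using l_pos l_u by simp
    then have cly: "ly \<le> c" by (rule power2_le_imp_le) (use c0 in simp)
    show ?thesis
    proof (cases "lx \<le> b")
      case True
      then have "in_hull b c l"
        using bu u_1 l_u cly c1 bc by (intro in_hull_product) (auto simp: feasible_def)
      from in_hull_mix[OF apex this t0 t1 _ _ refl]
      have "in_hull x y ((1 - t) * u + t * l)"
        using pt qt by (simp add: p_def q_def algebra_simps)
      moreover have "z \<le> (1 - t) * u + t * l" using zt by (simp add: algebra_simps)
      ultimately show ?thesis by blast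
    next
      case False
      \<comment> \<open>Chosen so that \<open>u - p / \<sigma> = lx\<close>.\<close>
      define \<sigma> where "\<sigma> = p / (u - lx)"
      have \<sigma>: "p = \<sigma> * (u - lx)" "t \<le> \<sigma>" "\<sigma> \<le> 1"
      proof -
        show "p = \<sigma> * (u - lx)" using lx_less_u by (simp add: \<sigma>_def)
        have "t * (u - lx) \<le> p" unfolding pt using False tp by (intro mult_left_mono) auto
        then show "t \<le> \<sigma>" using lx_less_u by (simp add: \<sigma>_def pos_le_divide_eq)
        show "\<sigma> \<le> 1" using lx_less_u box by (simp add: \<sigma>_def p_def)
      qed
      define y2 where "y2 = 1 - q / \<sigma>"
      have qs: "q = \<sigma> * (1 - y2)" using \<sigma> tp by (simp add: y2_def)
      have cy: "c \<le> y2" using \<sigma> tp q by (simp add: y2_def c_def frac_le)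
      have y21: "y2 \<le> 1" using q \<sigma> tp by (simp add: y2_def)
      have "l \<le> lx * y2" unfolding bc[symmetric] using False cy b0 c0 by (intro mult_mono) auto
      moreover have "lx * y2 \<le> lx * 1" using y21 lx_pos by (intro mult_left_mono) auto
      ultimately have "in_hull lx y2 (lx * y2)"
        using cy cly y21 lx_u u_1 by (intro in_hull_product) (auto simp: feasible_def)
      from in_hull_mix[OF apex this _ \<sigma>(3) _ _ refl]
      have "in_hull x y ((1 - \<sigma>) * u + \<sigma> * (lx * y2))"
        using \<sigma> tp qs by (simp add: p_def q_def algebra_simps)
      moreover have "(1 - \<sigma>) * u + \<sigma> * (lx * y2) = x + lx * y - lx"
      proof -
        have "(1 - \<sigma>) * u + \<sigma> * (lx * y2) = u - \<sigma> * (u - lx) - lx * (\<sigma> * (1 - y2))"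
          by (simp add: algebra_simps)
        also have "\<dots> = u - p - lx * q" by (simp flip: \<sigma>(1) qs)
        finally show ?thesis by (simp add: p_def q_def algebra_simps)
      qed
      moreover have "z \<le> x + lx * y - lx" using rlt by (simp add: RLT_def)
      ultimately show ?thesis by auto
    qed
  qed
qed

section \<open>Hull points below: two RLT facets and the bottom face\<close>

text \<open>The facet \<open>z = x + y - 1\<close> touches the surface along \<open>x = 1\<close>
  and \<open>y = 1\<close>. Seen from the corner \<open>(1, 1)\<close>, the relevant part is the
  quadrilateral with vertices \<open>(u, 1)\<close>, \<open>(1, u)\<close>, \<open>(lx, 1)\<close>,
  \<open>(1, ly)\<close>.\<close>

lemma in_hull_upper_corner:
  assumes "x \<le> 1" "y \<le> 1" "x + y \<le> 1 + u" "ly * x + lx * y - lx * ly \<le> x + y - 1"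
  shows "in_hull x y (x + y - 1)"
proof -
  have lt: "lx < 1" "ly < 1" using lx_u ly_u u_1 by auto
  have "1 \<le> (1 - x) / (1 - u) + (1 - y) / (1 - u)"
    using u_1 assms by (simp add: add_divide_distrib[symmetric])
  moreover have "(1 - x) * (1 - ly) + (1 - y) * (1 - lx) \<le> (1 - lx) * (1 - ly)"
    using assms by (simp add: algebra_simps)
  then have "(1 - x) / (1 - lx) + (1 - y) / (1 - ly) \<le> 1"
    using lt by (simp add: add_frac_eq)
  ultimately obtain s t t' where w: "0 \<le> s" "s \<le> 1" "0 \<le> t" "t \<le> 1" "0 \<le> t'" "t' \<le> 1"
    and eq: "1 - x = (1 - s) * ((1 - t) * (1 - u)) + s * ((1 - t') * (1 - lx))"
      "1 - y = (1 - s) * (t * (1 - u)) + s * (t' * (1 - ly))"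
    using ex_quadrilateral_weights[of "1 - x" "1 - y" "1 - u" "1 - u" "1 - lx" "1 - ly"] lt u_1 assms
    by auto
  have "in_hull u 1 u" "in_hull 1 u u" "in_hull lx 1 lx" "in_hull 1 ly ly"
    using lx_u ly_u u_1 l_u l_lx l_ly lt by (auto intro!: in_hull_product simp: feasible_def)
  then have "in_hull ((1 - t) * u + t * 1) ((1 - t) * 1 + t * u) ((1 - t) * u + t * u)"
    "in_hull ((1 - t') * lx + t' * 1) ((1 - t') * 1 + t' * ly) ((1 - t') * lx + t' * ly)"
    by (blast intro: in_hull_mix[OF _ _ w(3,4) refl refl refl] in_hull_mix[OF _ _ w(5,6) refl refl refl])+
  then show ?thesis
    by (rule in_hull_mix[OF _ _ w(1,2)]) (use eq in \<open>auto simp: algebra_simps\<close>)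
qed

text \<open>This facet touches the surface along \<open>x = lx\<close> and \<open>y = ly\<close>.
  Seen from the corner \<open>(lx, ly)\<close>, the quadrilateral has vertices
  \<open>(l / ly, ly)\<close>, \<open>(lx, l / lx)\<close>, \<open>(1, ly)\<close>,
  \<open>(lx, 1)\<close>.\<close>

lemma in_hull_lower_corner:
  assumes "lx \<le> x" "ly \<le> y" "x + y - 1 \<le> ly * x + lx * y - lx * ly"
    "l \<le> ly * x + lx * y - lx * ly"
  shows "in_hull x y (ly * x + lx * y - lx * ly)"
proof -
  define m n where "m = l / ly" and "n = l / lx"
  have mn: "m * ly = l" "lx * n = l" using lx_pos ly_pos by (auto simp: m_def n_def)
  have m: "lx < m" "m < 1" and n: "ly < n" "n \<le> 1"
    using lx_ly l_less_ly l_lx lx_pos ly_pos by (auto simp: m_def n_def field_simps)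
  have lt: "lx < 1" "ly < 1" using lx_u ly_u u_1 by auto
  have "1 \<le> (x - lx) / (m - lx) + (y - ly) / (n - ly)"
  proof -
    have k: "ly * (m - lx) = l - lx * ly" "lx * (n - ly) = l - lx * ly"
      using mn by (auto simp: algebra_simps)
    have "(x - lx) / (m - lx) = ly * (x - lx) / (l - lx * ly)"
      unfolding k(1)[symmetric] using ly_pos by simp
    moreover have "(y - ly) / (n - ly) = lx * (y - ly) / (l - lx * ly)"
      unfolding k(2)[symmetric] using lx_pos by simp
    ultimately show ?thesis
      using lx_ly assms(4) by (simp add: add_divide_distrib[symmetric] algebra_simps)
  qed
  moreover have "(x - lx) * (1 - ly) + (y - ly) * (1 - lx) \<le> (1 - lx) * (1 - ly)"
    using assms by (simp add: algebra_simps)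
  then have "(x - lx) / (1 - lx) + (y - ly) / (1 - ly) \<le> 1"
    using lt by (simp add: add_frac_eq)
  ultimately obtain s t t' where w: "0 \<le> s" "s \<le> 1" "0 \<le> t" "t \<le> 1" "0 \<le> t'" "t' \<le> 1"
    and eq: "x - lx = (1 - s) * ((1 - t) * (m - lx)) + s * ((1 - t') * (1 - lx))"
      "y - ly = (1 - s) * (t * (n - ly)) + s * (t' * (1 - ly))"
    using ex_quadrilateral_weights[of "x - lx" "y - ly" "m - lx" "n - ly" "1 - lx" "1 - ly"] lt m n assms
    by auto
  have "in_hull m ly (m * ly)" "in_hull lx n (lx * n)" "in_hull 1 ly ly" "in_hull lx 1 lx"
    using lx_u ly_u u_1 l_u l_lx l_ly m n mn by (simp_all add: in_hull_product feasible_def)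
  then have "in_hull ((1 - t) * m + t * lx) ((1 - t) * ly + t * n) ((1 - t) * (m * ly) + t * (lx * n))"
    "in_hull ((1 - t') * 1 + t' * lx) ((1 - t') * ly + t' * 1) ((1 - t') * ly + t' * lx)"
    by (blast intro: in_hull_mix[OF _ _ w(3,4) refl refl refl] in_hull_mix[OF _ _ w(5,6) refl refl refl])+
  then show ?thesis
  proof (rule in_hull_mix[OF _ _ w(1,2)])
    have x: "x = lx + ((1 - s) * ((1 - t) * (m - lx)) + s * ((1 - t') * (1 - lx)))"
      and y: "y = ly + ((1 - s) * (t * (n - ly)) + s * (t' * (1 - ly)))"
      using eq by auto
    show "x = (1 - s) * ((1 - t) * m + t * lx) + s * ((1 - t') * 1 + t' * lx)"
      by (subst x) (simp add: algebra_simps)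
    show "y = (1 - s) * ((1 - t) * ly + t * n) + s * ((1 - t') * ly + t' * 1)"
      by (subst y) (simp add: algebra_simps)
    show "ly * x + lx * y - lx * ly = (1 - s) * ((1 - t) * (m * ly) + t * (lx * n)) + s * ((1 - t') * ly + t' * lx)"
      unfolding x y by (simp add: algebra_simps)
  qed
qed

text \<open>At fixed \<open>y\<close>, the point lies between the hyperbola at \<open>l / y\<close>
  and the chord joining \<open>(l / ly, ly)\<close> to \<open>(lx, l / lx)\<close>, on which the
  lower RLT facet has height \<open>l\<close>.\<close>

lemma in_hull_level_l:
  assumes "lx \<le> x" "ly \<le> y" "y \<le> 1" "l \<le> x * y" "ly * x + lx * y - lx * ly \<le> l"
  shows "in_hull x y l"
proof -
  define m n where "m = l / ly" and "n = l / lx"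
  have mn: "m * ly = l" "lx * n = l" using lx_pos ly_pos by (auto simp: m_def n_def)
  have m: "lx < m" "m < 1" and n: "ly < n" "n \<le> 1"
    using lx_ly l_less_ly l_lx lx_pos ly_pos by (auto simp: m_def n_def field_simps)
  have y0: "0 < y" using assms ly_pos by simp
  have "ly * lx \<le> ly * x" using assms ly_pos by (intro mult_left_mono) auto
  then have "lx * y \<le> lx * n" using assms(5) mn by (simp add: mult.commute)
  then have yn: "y \<le> n" using lx_pos by simp
  have "in_hull (l / y) y l"
  proof (rule in_hull_product)
    have "lx * y \<le> l" using yn lx_pos mn by (metis mult_left_mono less_imp_le)
    then show "feasible (l / y) y"
      using y0 assms l_ly l_u by (auto simp: feasible_def pos_le_divide_eq)
  qed (use y0 in simp)
  moreover define t where "t = (y - ly) / (n - ly)"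
  have t: "0 \<le> t" "t \<le> 1" "y = (1 - t) * ly + t * n"
  proof -
    show "0 \<le> t" "t \<le> 1" using assms yn n by (auto simp: t_def)
    have "t * (n - ly) = y - ly" using n by (simp add: t_def)
    then show "y = (1 - t) * ly + t * n" by (simp add: algebra_simps)
  qed
  have "in_hull m ly l" "in_hull lx n l"
    using ly_u lx_u u_1 l_u m n mn by (simp_all add: in_hull_product feasible_def)
  then have "in_hull ((1 - t) * m + t * lx) y l"
    by (rule in_hull_mix) (use t in \<open>auto simp: algebra_simps\<close>)
  moreover have "l / y \<le> x" using assms y0 by (simp add: pos_divide_le_eq)
  moreover have "x \<le> (1 - t) * m + t * lx"
  proof -
    have "ly * x \<le> l + lx * ly - lx * y" using assms by simp
    also have "\<dots> = (1 - t) * l + t * (lx * ly) + t * (l - lx * n)"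
      by (subst t(3)) (simp add: algebra_simps)
    also have "\<dots> = ly * ((1 - t) * m + t * lx)"
      using mn by (simp add: algebra_simps)
    finally show ?thesis using ly_pos by simp
  qed
  ultimately show ?thesis by (rule in_hull_between_x)
qed

section \<open>Assembly of the two inclusions\<close>

lemma in_hullI:
  assumes rlt: "RLT lx ly x y z" and z: "l \<le> z" "z \<le> u"
    and soc1: "ly\<^sup>2 / l * x \<le> y \<Longrightarrow> y \<le> x / u \<Longrightarrow> SOC1 l u x y z"
    and soc2: "y \<le> ly\<^sup>2 / l * x \<Longrightarrow> SOC2 ly l u x y z"
    and soc3: "x \<le> u * y \<Longrightarrow> SOC3 l u x y z"
  shows "in_hull x y z"
proof -
  note box = RLT_box[OF rlt]
  have pos: "0 < x" "0 < y" using box lx_pos ly_pos by auto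
  have upper: "\<exists>Z\<ge>z. in_hull x y Z"
  proof -
    consider "u \<le> x * y" | "x * y \<le> u" "y \<le> ly\<^sup>2 / l * x" | "x \<le> u * y"
      | "x * y \<le> u" "ly\<^sup>2 / l * x \<le> y" "u * y \<le> x"
      by linarith
    then show ?thesis
    proof cases
      case 1
      \<comment> \<open>The chord condition \<open>x + y \<le> 1 + u\<close> follows from
        \<open>x + y - 1 \<le> z \<le> u\<close>.\<close>
      then have "in_hull x y u" using box pos rlt z by (intro in_hull_level_u) (auto simp: RLT_def)
      then show ?thesis using z by auto
    next
      case 2
      then show ?thesis using ex_in_hull_above_SOC2[OF rlt _ soc2 z(1)] by simp
    next
      case 3
      then show ?thesis using ex_in_hull_above_SOC3[OF rlt _ soc3 z] by simp
    next
      case 4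
      then have "y \<le> x / u" using l_pos l_u by (simp add: pos_le_divide_eq mult.commute)
      then show ?thesis using ex_in_hull_above_SOC1[OF pos _ _ soc1 z(1)] 4 by simp
    qed
  qed
  then obtain Z where Z: "z \<le> Z" "in_hull x y Z" by auto
  \<comment> \<open>The hull point found above satisfies \<open>SOC1\<close> at height
    \<open>Z \<ge> l\<close>, which yields the product bound used for the bottom face.\<close>
  have xy: "l \<le> x * y"
    using SOC1_product_ge[OF SOC1_of_in_hull[OF Z(2)]] Z z by simp
  obtain Z' where "Z' \<le> z" "in_hull x y Z'"
  proof -
    let ?A = "x + y - 1" and ?B = "ly * x + lx * y - lx * ly"
    have AB: "?A \<le> z" "?B \<le> z" using rlt by (auto simp: RLT_def)
    \<comment> \<open>The facets of heights \<open>?A\<close> and \<open>?B\<close> meet over the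
      chord from \<open>(lx, 1)\<close> to \<open>(1, ly)\<close>; \<open>?B\<close> meets level
      \<open>l\<close> over the chord from \<open>(l / ly, ly)\<close> to
      \<open>(lx, l / lx)\<close>.\<close>
    consider "?B \<le> ?A" | "?A \<le> ?B" "l \<le> ?B" | "?B \<le> l" by linarith
    then show ?thesis
    proof cases
      case 1
      then show ?thesis using in_hull_upper_corner[of x y] box AB z that by auto
    next
      case 2
      then show ?thesis using in_hull_lower_corner[of x y] box AB that by auto
    next
      case 3
      then show ?thesis using in_hull_level_l[of x y] box xy z that by auto
    qed
  qed
  then show ?thesis using Z by (blast intro: in_hull_between_z)
qed

end

theorem proposition8:
  fixes lx ly lz uz :: real
  assumes "0 < lz" and "lz < uz" and "uz < 1"
    and "lz \<le> lx" and "lx \<le> uz"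
    and "lz \<le> ly" and "ly \<le> uz"
    and "lx * ly < lz"
    and "region_C lx ly lz uz"
  shows "positive_semidefinite (M2 lz uz) \<and>
    convex hull (bounded_product_set lx ly lz uz) =
      {vector [x, y, z] | x y z.
         RLT lx ly x y z \<and> lz \<le> z \<and> z \<le> uz \<and>
         (y \<ge> (ly\<^sup>2 / lz) * x \<and> y \<le> x / uz \<longrightarrow> SOC1 lz uz x y z) \<and>
         (y \<le> (ly\<^sup>2 / lz) * x \<longrightarrow> SOC2 ly lz uz x y z) \<and>
         (x \<le> uz * y \<longrightarrow> SOC3 lz uz x y z)}"
proof
  show "positive_semidefinite (M2 lz uz)"
    using assms by (intro positive_semidefinite_M2) auto
  have pos: "0 < lx" "0 < ly" "0 < uz" using assms by auto
  have C: "lx \<le> sqrt (lz * uz)" "sqrt (lz * uz) \<le> ly" "ly \<le> sqrt (lz / uz)"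
    using assms(9) by (auto simp: region_C_def)
  have "lx\<^sup>2 \<le> lz * uz" using C(1) power_mono[of lx "sqrt (lz * uz)" 2] pos assms(1) by simp
  moreover have "lz * uz \<le> ly\<^sup>2" using C(2) by (rule sqrt_le_D)
  moreover have "ly\<^sup>2 * uz \<le> lz"
  proof -
    have "ly\<^sup>2 \<le> (sqrt (lz / uz))\<^sup>2" using C(3) pos by (intro power_mono) auto
    then show ?thesis using pos assms(1) by (simp add: pos_le_divide_eq)
  qed
  ultimately interpret region_C_box lx ly lz uz
    using assms by unfold_locales auto
  show "convex hull (bounded_product_set lx ly lz uz) =
      {vector [x, y, z] | x y z.
         RLT lx ly x y z \<and> lz \<le> z \<and> z \<le> uz \<and>
         (y \<ge> (ly\<^sup>2 / lz) * x \<and> y \<le> x / uz \<longrightarrow> SOC1 lz uz x y z) \<and>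
         (y \<le> (ly\<^sup>2 / lz) * x \<longrightarrow> SOC2 ly lz uz x y z) \<and>
         (x \<le> uz * y \<longrightarrow> SOC3 lz uz x y z)}" (is "_ = ?R")
  proof
    show "?R \<subseteq> convex hull (bounded_product_set lx ly lz uz)"
      by clarify (rule in_hullI; simp)
    show "convex hull (bounded_product_set lx ly lz uz) \<subseteq> ?R"
    proof
      fix v :: "real ^ 3"
      assume v: "v \<in> convex hull (bounded_product_set lx ly lz uz)"
      have eq: "v = vector [v $ 1, v $ 2, v $ 3]" by (simp add: vec_eq_iff forall_3)
      have h: "in_hull (v $ 1) (v $ 2) (v $ 3)" using v eq by simp
      show "v \<in> ?R"
        by (rule CollectI, intro exI, rule conjI[OF eq])
          (use bounds_of_in_hull[OF h] in \<open>intro conjI impI RLT_of_in_hull[OF h] SOC1_of_in_hull[OF h]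
            SOC2_of_in_hull[OF h] SOC3_of_in_hull[OF h]\<close>)
    qed
  qed
qed

end
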